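(* Let $\mathcal{G}=(\mathcal{V},\mathcal{E})$ be a connected undirected (static) graph with $\mathcal{V}=\{1,\dots,N\}$, and let $d$ be the diameter of $\mathcal{G}$. Let each agent $i\in\mathcal{V}$ hold a strictly positive integer $x_i\le M$ and a prime $p_i$, the primes $p_1,\dots,p_N$ being pairwise distinct, and let $\mathcal{T}_i(k)$, for $i\in\mathcal{V}$ and integers $k\ge 0$, be the tables generated by the PrimeTime algorithm. Then for every integer $k\ge d$ and every $i\in\mathcal{V}$, the table $\mathcal{T}_i(k)$ contains the data of all agents in the network, i.e. $(x_j,p_j)\in\mathcal{T}_i(k)$ for all $j\in\mathcal{V}$; and this happens no sooner, i.e. for every integer $k$ with $0\le k<d$ there exist $i,j\in\mathcal{V}$ such that $(x_j,p_j)\notin\mathcal{T}_i(k)$.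
   Context: Nodes of $\mathcal{G}$ are agents and edges are communication links; $\mathcal{N}_i$ denotes the set of neighbors of agent $i$ in $\mathcal{G}$. The diameter $d$ is the maximum over pairs of nodes of the graph distance (number of hops in a shortest path). $M$ is a fixed integer upper bound on the data $x_j$. The PrimeTime algorithm runs synchronously in discrete time $k=0,1,2,\dots$. Each agent $i$ maintains a table $\mathcal{T}_i(k)$, a set of ordered pairs (data value, prime), initialized as $\mathcal{T}_i(0)=\{(x_i,p_i)\}$. At each time $k\ge 0$: (1) Each agent $i$ transmits to all its neighbors the integer message $$m_i(k)=\prod_{\{j:(x_j,p_j)\in\mathcal{T}_i(k)\}}p_j^{x_j}.$$ (2) Each agent $i$ receives $m_j(k)$ from every $j\in\mathcal{N}_i$ and computes its prime factorization. Let $\mathcal{L}_j(k)$ be the set of agents whose data is included in $m_j(k)$, i.e. the set of $l\in\mathcal{V}$ such that $p_l$ divides $m_j(k)$. For each $l\in\mathcal{L}_j(k)$ the datum $x_l$ is recovered as the exponent of $p_l$ in the prime factorization of $m_j(k)$. (3) Each agent $i$ updates its table by $$\mathcal{T}_i(k+1)=\mathcal{T}_i(k)\cup\Big\{(x_l,p_l): l\in\bigcup_{j\in\mathcal{N}_i}\mathcal{L}_j(k)\Big\}.$$ The data $x_i$ and the primes $p_i$ do not change over time. *)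

theory Defs
  imports
    "Graph_Theory.Graph_Theory"
    "HOL-Computational_Algebra.Primes"
begin

section \<open>Graph distance and diameter\<close>

text \<open>
  An undirected simple graph is a \<open>pair_graph\<close> of the entry \<open>Graph_Theory\<close>: a finite, symmetric,
  loop-free set of ordered pairs. The value of \<open>hop_dist\<close> is meaningful only if \<open>v\<close> is
  reachable from \<open>u\<close>, and that of \<open>diameter\<close> only if the graph is finite, nonempty and connected.
\<close>

definition hop_dist :: "'a pair_pre_digraph \<Rightarrow> 'a \<Rightarrow> 'a \<Rightarrow> nat" where
  "hop_dist G u v = (LEAST n. \<exists>es. pre_digraph.apath (with_proj G) u es v \<and> length es = n)"

definition diameter :: "'a pair_pre_digraph \<Rightarrow> nat" where
  "diameter G = Max {hop_dist G u v | u v. u \<in> pverts G \<and> v \<in> pverts G}"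

definition neighbors :: "'a pair_pre_digraph \<Rightarrow> 'a \<Rightarrow> 'a set" where
  "neighbors G i = {j. (i, j) \<in> parcs G}"


section \<open>The PrimeTime algorithm\<close>

text \<open>A table is a set of pairs (data value, prime).\<close>

type_synonym table = "(nat \<times> nat) set"

text \<open>The product ranges over agents, not over the entries of the table.\<close>

definition message :: "'a set \<Rightarrow> ('a \<Rightarrow> nat) \<Rightarrow> ('a \<Rightarrow> nat) \<Rightarrow> table \<Rightarrow> nat" where
  "message V x p T = (\<Prod>j\<in>{j \<in> V. (x j, p j) \<in> T}. p j ^ x j)"

definition included_agents :: "'a set \<Rightarrow> ('a \<Rightarrow> nat) \<Rightarrow> nat \<Rightarrow> 'a set" where
  "included_agents V p m = {l \<in> V. p l dvd m}"

text \<open>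
  An agent learns the datum of \<open>l\<close> only from the messages it receives. The update therefore
  inserts the recovered value, the exponent of \<open>p l\<close> in the factorization of the message, and
  not \<open>x l\<close> itself; the two agree by \<open>recovered_datum\<close> and \<open>prime_time_Suc\<close> below.
\<close>

primrec prime_time :: "'a pair_pre_digraph \<Rightarrow> ('a \<Rightarrow> nat) \<Rightarrow> ('a \<Rightarrow> nat) \<Rightarrow> nat \<Rightarrow> 'a \<Rightarrow> table" where
  "prime_time G x p 0 = (\<lambda>i. {(x i, p i)})"
| "prime_time G x p (Suc k) =
     (\<lambda>i. prime_time G x p k i \<union>
       (\<Union>j\<in>neighbors G i.
          let m = message (pverts G) x p (prime_time G x p k j)
          in {(count (prime_factorization m) (p l), p l) | l. l \<in> included_agents (pverts G) p m}))"


section \<open>Consistency with the informal definitions\<close>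

lemma recovered_datum:
  assumes "finite V" "\<And>j. j \<in> V \<Longrightarrow> prime (p j)" "inj_on p V"
    and "l \<in> included_agents V p (message V x p T)"
  shows "count (prime_factorization (message V x p T)) (p l) = x l"
proof -
  let ?A = "{j \<in> V. (x j, p j) \<in> T}"
  have fin: "finite ?A" using assms(1) by simp
  have l: "l \<in> V" "p l dvd (\<Prod>j\<in>?A. p j ^ x j)"
    using assms(4) by (auto simp: included_agents_def message_def)
  have pl: "prime (p l)" using assms(2) l(1) by blast
  obtain j where j: "j \<in> ?A" "p l dvd p j ^ x j"
    using l(2) pl fin by (auto simp: prime_dvd_prod_iff)
  have "p l dvd p j" using j(2) pl prime_dvd_power by blast
  moreover have "prime (p j)" using j(1) assms(2) by blast
  ultimately have "p l = p j" using pl primes_dvd_imp_eq by blast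
  then have "l = j" using assms(3) l(1) j(1) by (auto dest: inj_onD)
  then have lA: "l \<in> ?A" using j(1) by simp
  have "multiplicity (p l) (\<Prod>j\<in>?A. p j ^ x j) = (\<Sum>j\<in>?A. multiplicity (p l) (p j ^ x j))"
    using fin assms(2) pl
    by (intro prime_elem_multiplicity_prod_distrib) (auto simp: image_iff prime_gt_0_nat)
  also have "\<dots> = (\<Sum>j\<in>?A. if j = l then x l else 0)"
  proof (rule sum.cong[OF refl])
    fix j assume jA: "j \<in> ?A"
    then have pj: "prime (p j)" using assms(2) by blast
    show "multiplicity (p l) (p j ^ x j) = (if j = l then x l else 0)"
    proof (cases "j = l")
      case True
      then show ?thesis using pl by (simp add: prime_elem_multiplicity_power_distrib)
    next
      case False
      then have "p l \<noteq> p j" using assms(3) l(1) jA by (auto dest: inj_onD)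
      then show ?thesis using False pl pj by (simp add: multiplicity_distinct_prime_power)
    qed
  qed
  also have "\<dots> = x l" using fin lA by simp
  finally show ?thesis using pl by (simp add: message_def count_prime_factorization_prime)
qed

lemma prime_time_Suc:
  assumes "pair_graph G" "\<And>j. j \<in> pverts G \<Longrightarrow> prime (p j)" "inj_on p (pverts G)"
  shows "prime_time G x p (Suc k) i = prime_time G x p k i \<union>
    {(x l, p l) | l. l \<in> (\<Union>j\<in>neighbors G i.
       included_agents (pverts G) p (message (pverts G) x p (prime_time G x p k j)))}"
proof -
  interpret pair_graph G by fact
  have "{(count (prime_factorization (message (pverts G) x p T)) (p l), p l) | l.
           l \<in> included_agents (pverts G) p (message (pverts G) x p T)}
      = (\<lambda>l. (x l, p l)) ` included_agents (pverts G) p (message (pverts G) x p T)" for T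
    unfolding Setcompr_eq_image
    using recovered_datum[OF pair_finite_verts assms(2,3)] by (intro image_cong) auto
  then show ?thesis
    by (simp only: prime_time.simps Let_def) blast
qed

text \<open>The hop distance is the weighted distance \<open>\<mu>\<close> of \<open>Graph_Theory\<close> for unit weights.\<close>

lemma hop_dist_eq_mu:
  assumes "pair_graph G" and reach: "u \<rightarrow>\<^sup>*\<^bsub>with_proj G\<^esub> v"
  shows "ereal (real (hop_dist G u v)) = wf_digraph.\<mu> (with_proj G) (\<lambda>_. 1) u v"
proof -
  interpret pair_graph G by fact
  let ?P = "\<lambda>n. \<exists>es. apath u es v \<and> length es = n"
  have cost: "awalk_cost (\<lambda>_. 1) es = real (length es)" for es
    by (induct es) auto
  obtain es where es: "apath u es v" "\<mu> (\<lambda>_. 1) u v = ereal (awalk_cost (\<lambda>_. 1) es)"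
    using no_neg_cyc_reach_imp_path[OF reach, of "\<lambda>_. 1"] by (auto simp: cost)
  have "hop_dist G u v \<le> length es"
    unfolding hop_dist_def by (rule Least_le) (use es(1) in blast)
  moreover have "?P (hop_dist G u v)"
    unfolding hop_dist_def by (rule LeastI_ex) (use es(1) in blast)
  then obtain es' where es': "apath u es' v" "length es' = hop_dist G u v" by blast
  have "\<mu> (\<lambda>_. 1) u v \<le> ereal (awalk_cost (\<lambda>_. 1) es')"
    using es'(1) by (intro min_cost_le_walk_cost) (simp add: apath_def)
  then have "length es \<le> hop_dist G u v" using es(2) es'(2) by (simp add: cost)
  ultimately show ?thesis using es(2) by (simp add: cost)
qed

end

theory Submission
  imports Defs
begin

text \<open>
  Information travels exactly one hop per round. A message is a product of powers of distinct
  primes with positive exponents, so the agents that can be read off it are exactly those in the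
  sender's table (\<open>included_agents_message\<close>). Hence agent \<open>i\<close> holds the datum of \<open>l\<close> after
  \<open>k + 1\<close> rounds iff \<open>i\<close> or one of its neighbors holds it after \<open>k\<close> rounds, which is the
  recursion satisfied by ``some walk from \<open>i\<close> to \<open>l\<close> has at most \<open>k\<close> edges''. So the table of \<open>i\<close>
  at time \<open>k\<close> contains the datum of \<open>l\<close> iff the hop distance from \<open>i\<close> to \<open>l\<close> is at most \<open>k\<close>
  (\<open>mem_prime_time_iff_hop_dist\<close>). Both halves of the theorem follow because the diameter bounds
  all hop distances and is attained by some pair of agents.
\<close>

text \<open>
  Positive data are essential: a datum \<open>0\<close> would contribute the factor \<open>1\<close> and leave no trace
  in the message. Distinct primes prevent one agent's factor from being mistaken for another's.
\<close>

lemma included_agents_message: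
  assumes "finite V" "\<And>j. j \<in> V \<Longrightarrow> prime (p j)" "inj_on p V" "\<And>j. j \<in> V \<Longrightarrow> 0 < x j"
  shows "included_agents V p (message V x p T) = {l \<in> V. (x l, p l) \<in> T}"
proof (intro equalityI subsetI)
  fix l assume "l \<in> included_agents V p (message V x p T)"
  then have l: "l \<in> V" and "p l dvd (\<Prod>j\<in>{j \<in> V. (x j, p j) \<in> T}. p j ^ x j)"
    by (auto simp: included_agents_def message_def)
  moreover have pl: "prime (p l)" using assms(2) l by blast
  ultimately obtain j where j: "j \<in> V" "(x j, p j) \<in> T" "p l dvd p j ^ x j"
    using assms(1) by (auto simp: prime_dvd_prod_iff)
  have "p l dvd p j" using prime_dvd_power pl j(3) by blast
  then have "p l = p j"
    using primes_dvd_imp_eq[OF pl] assms(2) j(1) by blast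
  then have "l = j" using assms(3) l j(1) by (auto dest: inj_onD)
  then show "l \<in> {l \<in> V. (x l, p l) \<in> T}" using j by simp
next
  fix l assume l: "l \<in> {l \<in> V. (x l, p l) \<in> T}"
  then have "p l ^ x l dvd message V x p T"
    unfolding message_def using assms(1) by (intro dvd_prodI) auto
  moreover have "p l dvd p l ^ x l" using assms(4) l by (simp add: dvd_power)
  ultimately show "l \<in> included_agents V p (message V x p T)"
    using l dvd_trans by (auto simp: included_agents_def)
qed

lemma mem_prime_time_Suc_iff:
  assumes "pair_graph G" "\<And>j. j \<in> pverts G \<Longrightarrow> prime (p j)" "inj_on p (pverts G)"
    and "\<And>j. j \<in> pverts G \<Longrightarrow> 0 < x j" and "l \<in> pverts G"
  shows "(x l, p l) \<in> prime_time G x p (Suc k) i \<longleftrightarrow>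
    (x l, p l) \<in> prime_time G x p k i \<or> (\<exists>j\<in>neighbors G i. (x l, p l) \<in> prime_time G x p k j)"
proof -
  interpret pair_graph G by fact
  have inj: "p l' = p l \<longleftrightarrow> l' = l" if "l' \<in> pverts G" for l'
    using assms(3,5) that by (auto dest: inj_onD)
  have msg: "included_agents (pverts G) p (message (pverts G) x p T) =
      {l \<in> pverts G. (x l, p l) \<in> T}" for T
    using pair_finite_verts assms(2-4) by (rule included_agents_message)
  have "prime_time G x p (Suc k) i = prime_time G x p k i \<union>
    {(x l, p l) | l. l \<in> (\<Union>j\<in>neighbors G i. {l \<in> pverts G. (x l, p l) \<in> prime_time G x p k j})}"
    using assms(1-3) unfolding msg[symmetric] by (rule prime_time_Suc)
  then show ?thesis
    using assms(5) inj by (auto simp del: prime_time.simps)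
qed

text \<open>
  Walks rather than paths make the induction work: prepending an edge to a walk gives a walk, but
  prepending one to a path may repeat a vertex.
\<close>

lemma mem_prime_time_iff_awalk:
  assumes "pair_graph G" "\<And>j. j \<in> pverts G \<Longrightarrow> prime (p j)" "inj_on p (pverts G)"
    and "\<And>j. j \<in> pverts G \<Longrightarrow> 0 < x j" and "l \<in> pverts G" and "i \<in> pverts G"
  shows "(x l, p l) \<in> prime_time G x p k i \<longleftrightarrow>
    (\<exists>es. pre_digraph.awalk (with_proj G) i es l \<and> length es \<le> k)"
proof -
  interpret pair_graph G by fact
  show ?thesis
    using assms(6)
  proof (induction k arbitrary: i)
    case 0
    then show ?case
      using assms(3,5) by (auto simp: awalk_Nil_iff dest: inj_onD)
  next
    case (Suc k)
    have nb: "j \<in> neighbors G i \<longleftrightarrow> (i, j) \<in> parcs G" for j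
      by (simp add: neighbors_def)
    have IH: "(x l, p l) \<in> prime_time G x p k j \<longleftrightarrow> (\<exists>es. awalk j es l \<and> length es \<le> k)"
      if "j \<in> neighbors G i" for j
      using that Suc.IH nb in_arcsD2 by blast
    have "(\<exists>es. awalk i es l \<and> length es \<le> Suc k) \<longleftrightarrow>
      (\<exists>es. awalk i es l \<and> length es \<le> k) \<or>
      (\<exists>j\<in>neighbors G i. \<exists>es. awalk j es l \<and> length es \<le> k)" (is "?L \<longleftrightarrow> ?R")
    proof
      assume ?L
      then obtain es where es: "awalk i es l" "length es \<le> Suc k" by blast
      show ?R
      proof (cases es)
        case Nil
        then show ?thesis using es by auto
      next
        case (Cons e fs)
        then have "e \<in> parcs G" "fst e = i" "awalk (snd e) fs l" "length fs \<le> k"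
          using es by (auto simp: awalk_Cons_iff)
        then show ?thesis using nb by (metis prod.collapse)
      qed
    next
      assume ?R
      then show ?L
      proof
        assume "\<exists>es. awalk i es l \<and> length es \<le> k"
        then show ?L by (meson le_SucI)
      next
        assume "\<exists>j\<in>neighbors G i. \<exists>es. awalk j es l \<and> length es \<le> k"
        then obtain j es where "(i, j) \<in> parcs G" "awalk j es l" "length es \<le> k"
          using nb by blast
        then have "awalk i ((i, j) # es) l" "length ((i, j) # es) \<le> Suc k"
          by (auto simp: awalk_Cons_iff)
        then show ?L by blast
      qed
    qed
    moreover have "(x l, p l) \<in> prime_time G x p (Suc k) i \<longleftrightarrow>
      (x l, p l) \<in> prime_time G x p k i \<or>
      (\<exists>j\<in>neighbors G i. (x l, p l) \<in> prime_time G x p k j)"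
      using assms(1-5) by (rule mem_prime_time_Suc_iff)
    ultimately show ?case
      using Suc.IH[OF Suc.prems] IH by (simp del: prime_time.simps)
  qed
qed

lemma ex_awalk_length_le_iff_hop_dist:
  assumes "pair_graph G" and reach: "u \<rightarrow>\<^sup>*\<^bsub>with_proj G\<^esub> v"
  shows "(\<exists>es. pre_digraph.awalk (with_proj G) u es v \<and> length es \<le> k) \<longleftrightarrow> hop_dist G u v \<le> k"
proof -
  interpret pair_graph G by fact
  have cost: "awalk_cost (\<lambda>_. 1) es = real (length es)" for es
    by (induct es) auto
  (* A walk may be longer than every path; the weighted distance bounds walks as well. *)
  have "hop_dist G u v \<le> length es" if "awalk u es v" for es
  proof -
    have "ereal (real (hop_dist G u v)) \<le> ereal (awalk_cost (\<lambda>_. 1) es)"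
      unfolding hop_dist_eq_mu[OF assms] using that by (rule min_cost_le_walk_cost)
    then show ?thesis by (simp add: cost)
  qed
  moreover have "\<exists>es. apath u es v \<and> length es = hop_dist G u v"
  proof -
    have "\<exists>n es. apath u es v \<and> length es = n"
      using reach reachable_apath by blast
    then show ?thesis
      unfolding hop_dist_def by (rule LeastI_ex)
  qed
  ultimately show ?thesis
    using awalkI_apath le_trans by metis
qed

lemma mem_prime_time_iff_hop_dist:
  assumes "pair_graph G" "\<And>j. j \<in> pverts G \<Longrightarrow> prime (p j)" "inj_on p (pverts G)"
    and "\<And>j. j \<in> pverts G \<Longrightarrow> 0 < x j" and "i \<rightarrow>\<^sup>*\<^bsub>with_proj G\<^esub> l"
  shows "(x l, p l) \<in> prime_time G x p k i \<longleftrightarrow> hop_dist G i l \<le> k"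
proof -
  interpret pair_graph G by fact
  have "l \<in> pverts G" "i \<in> pverts G"
    using reachable_in_verts[OF assms(5)] by simp_all
  with assms(1-4)
  have "(x l, p l) \<in> prime_time G x p k i \<longleftrightarrow> (\<exists>es. awalk i es l \<and> length es \<le> k)"
    by (rule mem_prime_time_iff_awalk)
  also have "\<dots> \<longleftrightarrow> hop_dist G i l \<le> k"
    using assms(1,5) by (rule ex_awalk_length_le_iff_hop_dist)
  finally show ?thesis .
qed

theorem theorem1:
  fixes N :: nat and M :: int
    and G :: "nat pair_pre_digraph"
    and x p :: "nat \<Rightarrow> nat"
  assumes "pair_graph G"
    and "pverts G = {1..N}"
    and "Digraph_Component.connected (with_proj G)"
    and "\<And>i. i \<in> {1..N} \<Longrightarrow> 0 < x i"
    and "\<And>i. i \<in> {1..N} \<Longrightarrow> int (x i) \<le> M"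
    and "\<And>i. i \<in> {1..N} \<Longrightarrow> prime (p i)"
    and "inj_on p {1..N}"
  shows "(\<forall>k\<ge>diameter G. \<forall>i\<in>{1..N}. \<forall>j\<in>{1..N}. (x j, p j) \<in> prime_time G x p k i) \<and>
         (\<forall>k<diameter G. \<exists>i\<in>{1..N}. \<exists>j\<in>{1..N}. (x j, p j) \<notin> prime_time G x p k i)"
proof -
  interpret pair_graph G by fact
  have sc: "strongly_connected (with_proj G)"
    using assms(3) sym_arcs by (rule symmetric_connected_imp_strongly_connected[rotated])
  then have ne: "pverts G \<noteq> {}"
    and reach: "\<And>i j. i \<in> {1..N} \<Longrightarrow> j \<in> {1..N} \<Longrightarrow> i \<rightarrow>\<^sup>*\<^bsub>with_proj G\<^esub> j"
    using assms(2) by (auto simp: strongly_connected_def)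
  have mem: "(x j, p j) \<in> prime_time G x p k i \<longleftrightarrow> hop_dist G i j \<le> k"
    if "i \<in> {1..N}" "j \<in> {1..N}" for i j k
    using mem_prime_time_iff_hop_dist[OF assms(1), of p x i j k] assms(2,4,6,7) reach[OF that]
    by simp
  let ?D = "{hop_dist G u v | u v. u \<in> pverts G \<and> v \<in> pverts G}"
  have "?D = (\<lambda>(u, v). hop_dist G u v) ` (pverts G \<times> pverts G)"
    by auto
  then have fin: "finite ?D" and "?D \<noteq> {}"
    using ne by simp_all
  then have "diameter G \<in> ?D"
    unfolding diameter_def by (intro Max_in)
  then obtain a b where ab: "a \<in> {1..N}" "b \<in> {1..N}" "hop_dist G a b = diameter G"
    using assms(2) by auto
  have le: "hop_dist G i j \<le> diameter G" if "i \<in> {1..N}" "j \<in> {1..N}" for i j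
    unfolding diameter_def using fin that assms(2) by (intro Max_ge) auto
  have "(x j, p j) \<in> prime_time G x p k i"
    if "diameter G \<le> k" "i \<in> {1..N}" "j \<in> {1..N}" for i j k
    using mem le that le_trans by blast
  moreover have "(x b, p b) \<notin> prime_time G x p k a" if "k < diameter G" for k
    using mem[OF ab(1,2)] ab(3) that by simp
  ultimately show ?thesis
    using ab(1,2) by blast
qed

end
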